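(* Let $d$ be a positive integer and $\varepsilon>0$, and set $n=n^*(d,\varepsilon)$. Let $\mathcal{F}$ be a finite family of convex sets in $\mathbb{R}^d$ such that for any subfamily $\mathcal{F}'\subset\mathcal{F}$ of at most $nd$ sets, $\operatorname{vol}\left(\bigcap\mathcal{F}'\right)\ge 1$. Then $$\operatorname{vol}\left(\bigcap\mathcal{F}\right)\ge(1+\varepsilon)^{-1}.$$ Moreover, if the condition is only required for subfamilies of size at most $n-1$, the conclusion may fail: there exists a finite family $\mathcal{F}$ of convex sets in $\mathbb{R}^d$ such that $\operatorname{vol}\left(\bigcap\mathcal{F}'\right)\ge1$ for every subfamily $\mathcal{F}'\subset\mathcal{F}$ of at most $n-1$ sets, but $\operatorname{vol}\left(\bigcap\mathcal{F}\right)<(1+\varepsilon)^{-1}$.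
   Context: For a positive integer $d$ and $\varepsilon>0$, $n^*(d,\varepsilon)$ denotes the smallest integer such that, for any convex set $K\subset\mathbb{R}^d$ with positive finite volume, there is a polytope $P\supset K$ with at most $n^*(d,\varepsilon)$ facets such that $\operatorname{vol}(P)\le(1+\varepsilon)\operatorname{vol}(K)$. A polytope is the convex hull of finitely many points; $\operatorname{vol}$ is $d$-dimensional volume (possibly $+\infty$). The intersection of the empty subfamily is $\mathbb{R}^d$. *)

theory Defs
  imports "HOL-Analysis.Analysis"
begin

text \<open>
  \<open>R^d\<close> is \<^typ>\<open>real^'d\<close> with \<open>d = CARD('d)\<close>, and \<open>vol\<close> is \<open>emeasure lebesgue\<close>, with values in
  \<open>[0, \<infinity>]\<close>; \<open>lebesgue\<close> is needed rather than \<open>lborel\<close> because a convex set need not be Borel.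

  A polytope has only finitely many facets (\<open>finite_polyhedron_facets\<close>), so \<open>card\<close> does not
  collapse to 0 here.  The type argument of \<open>n_star\<close> only carries the dimension.
\<close>

definition n_star :: "'d::finite itself \<Rightarrow> real \<Rightarrow> nat" where
  "n_star (_ :: 'd itself) \<epsilon> =
    (LEAST n. \<forall>K :: (real^'d) set.
       convex K \<and> 0 < emeasure lebesgue K \<and> emeasure lebesgue K < \<infinity> \<longrightarrow>
       (\<exists>P. polytope P \<and> K \<subseteq> P \<and> card {F. F facet_of P} \<le> n \<and>
            emeasure lebesgue P \<le> ennreal (1 + \<epsilon>) * emeasure lebesgue K))"

end

theory Submission imports Defs begin

text \<open>
  Let \<open>K = \<Inter>\<F>\<close> and let \<open>P \<supseteq> K\<close> be an \<open>n\<close>-facet polytope with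
  \<open>vol P \<le> (1 + \<epsilon>) vol K\<close>.  By Helly's theorem, applied to \<open>\<F>\<close> together with the
  open complement of a facet halfspace of \<open>P\<close>, each of these halfspaces already contains the
  intersection of \<open>d\<close> members of \<open>\<F>\<close>.  So \<open>P\<close> contains the intersection of \<open>n d\<close>
  members, and \<open>1 \<le> vol P\<close>.  If \<open>vol K = 0\<close> there is no such \<open>P\<close>; Helly's theorem for the
  interiors shows that \<open>d + 1 \<le> n d\<close> members then already have an intersection of volume 0.

  For the second part, take a \<open>K\<close> that is bad for \<open>n - 1\<close>.  By compactness the volumes of the
  intersections of at most \<open>n - 1\<close> halfspaces containing \<open>K\<close> are bounded below by some
  \<open>V > (1 + \<epsilon>) vol K\<close>.  The halfspaces of a sufficiently tight polytope around \<open>K\<close>, scaled so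
  that \<open>V\<close> becomes 1, form the required family.

  That \<open>n_star\<close> is the minimum of a nonempty set needs a bound on the number of facets that is
  uniform in \<open>K\<close>: after a linear change of coordinates \<open>K\<close> lies between two concentric balls with
  radii depending only on \<open>d\<close>, and the supporting halfspaces for a fine net of normals suffice.
\<close>

section \<open>Volume of convex sets: measurability, positivity, boundedness\<close>

definition halfspace :: "'a::euclidean_space set \<Rightarrow> bool" where
  "halfspace h \<longleftrightarrow> (\<exists>a b. a \<noteq> 0 \<and> h = {x. a \<bullet> x \<le> b})"

lemma halfspace_imp_convex: "halfspace h \<Longrightarrow> convex h"
  by (auto simp: halfspace_def convex_halfspace_le)

lemma halfspace_imp_polyhedron: "halfspace h \<Longrightarrow> polyhedron h"
  by (auto simp: halfspace_def polyhedron_halfspace_le)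

text \<open>A convex set is its open interior together with part of its frontier. The frontier is
  null, so completeness of the measure makes that part measurable.\<close>

lemma sets_lebesgue_convex:
  fixes S :: "'a::euclidean_space set"
  assumes "convex S"
  shows "S \<in> sets lebesgue"
proof -
  have "S \<inter> frontier S \<in> sets lebesgue"
    using negligible_convex_frontier[OF assms] negligible_subset
    by (metis Int_lower2 negligible_imp_sets)
  moreover have "interior S \<in> sets lebesgue"
    by (simp add: lborelD)
  moreover have "S = interior S \<union> (S \<inter> frontier S)"
    using closure_subset[of S] interior_subset[of S] by (auto simp: frontier_def)
  ultimately show ?thesis
    by (metis sets.Un)
qed

lemma emeasure_convex_pos_iff:
  fixes S :: "'a::euclidean_space set"
  assumes "convex S"
  shows "0 < emeasure lebesgue S \<longleftrightarrow> interior S \<noteq> {}"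
  using negligible_iff_emeasure0[OF sets_lebesgue_convex[OF assms]]
    negligible_convex_interior[OF assms] by (simp add: zero_less_iff_neq_zero)

lemma emeasure_closure_convex:
  fixes S :: "'a::euclidean_space set"
  assumes "convex S"
  shows "emeasure lebesgue (closure S) = emeasure lebesgue S"
proof (rule antisym)
  have S: "S \<in> sets lebesgue" and f: "frontier S \<in> null_sets lebesgue"
    using assms sets_lebesgue_convex negligible_convex_frontier negligible_iff_null_sets by blast+
  have "emeasure lebesgue (closure S) \<le> emeasure lebesgue (S \<union> frontier S)"
    using S f interior_subset[of S] by (intro emeasure_mono) (auto simp: frontier_def)
  also have "\<dots> = emeasure lebesgue S"
    using S f by (rule emeasure_Un_null_set)
  finally show "emeasure lebesgue (closure S) \<le> emeasure lebesgue S" .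
  show "emeasure lebesgue S \<le> emeasure lebesgue (closure S)"
    by (intro emeasure_mono closure_subset) (simp add: lborelD)
qed

text \<open>If \<open>S\<close> were unbounded, the hull of a ball in \<open>S\<close> and a far
  point of \<open>S\<close> would contain arbitrarily many disjoint balls of half the radius, strung
  along the segment between them.\<close>

lemma bounded_convex_finite_emeasure:
  fixes S :: "'a::euclidean_space set"
  assumes S: "convex S" and pos: "0 < emeasure lebesgue S" and fin: "emeasure lebesgue S < \<infinity>"
  shows "bounded S"
proof (rule ccontr)
  assume unb: "\<not> bounded S"
  from pos obtain p r where r: "r > 0" and ball: "ball p r \<subseteq> S"
    using emeasure_convex_pos_iff[OF S] by (meson ex_in_conv mem_interior)
  define c where "c = unit_ball_vol (real DIM('a)) * (r/2) ^ DIM('a)"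
  have c: "c > 0"
    using r by (simp add: c_def)
  obtain M where M: "M \<ge> 0" "emeasure lebesgue S = ennreal M"
    using fin by (metis ennreal_cases infinity_ennreal_def less_irrefl)
  obtain m :: nat where m: "real m * c > M"
    using c by (meson reals_Archimedean3)
  \<comment> \<open>At this distance the \<open>m\<close> centres \<open>q k\<close>, spaced
    \<open>r\<close> apart, lie in the first half of the segment from \<open>p\<close> to
    \<open>x\<close>.\<close>
  obtain x where x: "x \<in> S" "norm (x - p) > 2 * r * (real m + 1)"
  proof -
    have "\<not> S \<subseteq> cball p (2 * r * (real m + 1))"
      using unb bounded_subset bounded_cball by blast
    then show thesis
      using that by (force simp: dist_norm norm_minus_commute)
  qed
  define D where "D = norm (x - p)"
  have D: "D > 0" "D > 2 * r * (real m + 1)"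
  proof -
    have "0 \<le> 2 * r * (real m + 1)"
      using r by simp
    then show "D > 0" "D > 2 * r * (real m + 1)"
      using x unfolding D_def by linarith+
  qed
  define q where "q k = p + ((real k * r) / D) *\<^sub>R (x - p)" for k :: nat
  have sub: "ball (q k) (r/2) \<subseteq> S" if "k < m" for k
  proof
    fix y assume y: "y \<in> ball (q k) (r/2)"
    define t where "t = (real k * r) / D"
    have "real k * r \<le> real m * r"
      using that r by simp
    also have "\<dots> \<le> D / 2"
      using D r by (simp add: algebra_simps)
    finally have t: "0 \<le> t" "t \<le> 1/2"
      using D r by (auto simp: t_def field_simps)
    \<comment> \<open>\<open>z\<close> solves \<open>y = (1 - t) z + t x\<close>. As
      \<open>t \<le> 1/2\<close>, its distance from \<open>p\<close> is at most twice that of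
      \<open>y\<close> from \<open>q k\<close>, hence below \<open>r\<close>.\<close>
    define z where "z = p + (1 / (1 - t)) *\<^sub>R (y - q k)"
    have "norm (z - p) = norm (y - q k) / (1 - t)"
      using t by (simp add: z_def)
    also have "\<dots> < (r/2) / (1 - t)"
      using y t by (intro divide_strict_right_mono) (auto simp: dist_norm norm_minus_commute)
    also have "\<dots> \<le> (r/2) / (1/2)"
      using t r by (intro divide_left_mono) auto
    finally have "z \<in> S"
      using ball by (auto simp: dist_norm norm_minus_commute)
    then have "(1 - t) *\<^sub>R z + t *\<^sub>R x \<in> S"
      using S t x by (intro convexD) auto
    also have "(1 - t) *\<^sub>R z = (1 - t) *\<^sub>R p + (y - q k)"
      using t by (simp add: z_def scaleR_add_right)
    also have "\<dots> + t *\<^sub>R x = y"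
      by (simp add: q_def t_def algebra_simps)
    finally show "y \<in> S" .
  qed
  have disj: "disjoint_family_on (\<lambda>k. ball (q k) (r/2)) {..<m}"
    unfolding disjoint_family_on_def
  proof (intro ballI impI)
    fix i j assume ij: "i \<in> {..<m}" "j \<in> {..<m}" "i \<noteq> j"
    have "q i - q j = ((real i - real j) * r / D) *\<^sub>R (x - p)"
      by (simp add: q_def algebra_simps diff_divide_distrib)
    then have "dist (q i) (q j) = \<bar>real i - real j\<bar> * r"
      using D r by (simp add: dist_norm D_def abs_mult)
    also have "\<dots> \<ge> 1 * r"
      using ij r by (intro mult_right_mono) linarith+
    finally show "ball (q i) (r/2) \<inter> ball (q j) (r/2) = {}"
      by (intro disjoint_ballI) simp
  qed
  have "ennreal (real m * c) = (\<Sum>k<m. emeasure lebesgue (ball (q k) (r/2)))"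
    using r c by (simp add: emeasure_ball c_def[symmetric] ennreal_mult' ennreal_of_nat_eq_real_of_nat)
  also have "\<dots> = emeasure lebesgue (\<Union>k\<in>{..<m}. ball (q k) (r/2))"
    using disj by (intro sum_emeasure) auto
  also have "\<dots> \<le> emeasure lebesgue S"
    using sub S by (intro emeasure_mono) (auto intro: sets_lebesgue_convex)
  finally show False
    using m M by (simp add: ennreal_le_iff)
qed

section \<open>Few facets versus few halfspaces\<close>

lemma polytope_Inter_halfspaces:
  fixes G :: "'a::euclidean_space set set"
  assumes "finite G" "\<And>h. h \<in> G \<Longrightarrow> halfspace h" "bounded (\<Inter>G)"
  shows "polytope (\<Inter>G)"
  using assms by (simp add: polytope_eq_bounded_polyhedron halfspace_imp_polyhedron)

text \<open>In an irredundant representation every facet lies on the boundary hyperplane of one of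
  the halfspaces. Intersecting with the affine hull covers the case where the intersection is not
  full-dimensional.\<close>

lemma card_facets_Inter_halfspaces:
  fixes G :: "'a::euclidean_space set set"
  assumes fin: "finite G" and hs: "\<And>h. h \<in> G \<Longrightarrow> halfspace h"
  shows "card {F. F facet_of (\<Inter>G)} \<le> card G"
proof -
  define S where "S = \<Inter>G"
  have "S = affine hull S \<inter> \<Inter>G"
    by (metis Int_absorb1 S_def hull_subset)
  then have ex: "\<exists>G'. G' \<subseteq> G \<and> S = affine hull S \<inter> \<Inter>G'"
    by blast
  \<comment> \<open>Minimal cardinality makes \<open>G'\<close> irredundant, as
    \<open>facet_of_polyhedron_explicit\<close> requires.\<close>
  obtain G' where G': "G' \<subseteq> G" "S = affine hull S \<inter> \<Inter>G'"
    and min: "\<And>X. X \<subseteq> G \<and> S = affine hull S \<inter> \<Inter>X \<Longrightarrow> card G' \<le> card X"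
    using ex_has_least_nat[of "\<lambda>X. X \<subseteq> G \<and> S = affine hull S \<inter> \<Inter>X", where m = card] ex by metis
  have finG': "finite G'"
    using G' fin finite_subset by blast
  have "\<exists>a b. \<forall>h\<in>G'. a h \<noteq> 0 \<and> h = {x. a h \<bullet> x \<le> b h}"
    using hs G' unfolding halfspace_def by (metis subsetD)
  then obtain a b where ab: "\<And>h. h \<in> G' \<Longrightarrow> a h \<noteq> 0 \<and> h = {x. a h \<bullet> x \<le> b h}"
    by metis
  have "S \<subset> affine hull S \<inter> \<Inter>X" if "X \<subset> G'" for X
  proof -
    have "card X < card G'"
      using that finG' by (simp add: psubset_card_mono)
    then have "S \<noteq> affine hull S \<inter> \<Inter>X"
      using min[of X] that G' by (meson leD order.strict_implies_order order_trans)
    moreover have "S \<subseteq> affine hull S \<inter> \<Inter>X"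
      using G' that by (metis Inter_anti_mono Int_mono order_refl psubset_imp_subset)
    ultimately show ?thesis
      by blast
  qed
  note facet_of_polyhedron_explicit[OF finG' G'(2) ab this]
  then have "{F. F facet_of S} \<subseteq> (\<lambda>h. S \<inter> {x. a h \<bullet> x = b h}) ` G'"
    by auto
  then have "card {F. F facet_of S} \<le> card G'"
    using finG' by (meson card_image_le card_mono finite_imageI order_trans)
  also have "\<dots> \<le> card G"
    using G' fin by (simp add: card_mono)
  finally show ?thesis
    by (simp add: S_def)
qed

text \<open>Take one halfspace per facet. A segment from an interior point \<open>z\<close> to a
  point \<open>x\<close> outside \<open>P\<close> crosses the frontier on some facet
  \<open>C\<close>; but if \<open>x\<close> satisfied the inequality of \<open>C\<close>, then,
  \<open>z\<close> satisfying it strictly, so would the crossing point.\<close>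

lemma polytope_eq_Inter_halfspaces:
  fixes P :: "'a::euclidean_space set"
  assumes P: "polytope P" and int: "interior P \<noteq> {}"
  obtains G where "finite G" "card G \<le> card {F. F facet_of P}" "\<And>h. h \<in> G \<Longrightarrow> halfspace h"
    "P = \<Inter>G"
proof -
  have ph: "polyhedron P"
    using P polytope_imp_polyhedron by blast
  have "\<exists>a b. a \<noteq> 0 \<and> P \<subseteq> {x. a \<bullet> x \<le> b} \<and> C = P \<inter> {x. a \<bullet> x = b}" if "C facet_of P" for C
    using facet_of_polyhedron[OF ph that] by metis
  then obtain a b where ab: "\<And>C. C facet_of P \<Longrightarrow> a C \<noteq> 0 \<and> P \<subseteq> {x. a C \<bullet> x \<le> b C} \<and>
      C = P \<inter> {x. a C \<bullet> x = b C}"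
    by metis
  define G where "G = (\<lambda>C. {x. a C \<bullet> x \<le> b C}) ` {F. F facet_of P}"
  have fin: "finite {F. F facet_of P}"
    using ph finite_polyhedron_facets by blast
  have "\<Inter>G \<subseteq> P"
  proof
    fix x assume x: "x \<in> \<Inter>G"
    show "x \<in> P"
    proof (rule ccontr)
      assume nx: "x \<notin> P"
      obtain z where z: "z \<in> interior P"
        using int by blast
      then have "closed_segment z x \<inter> frontier P \<noteq> {}"
        using nx interior_subset[of P]
        by (intro connected_Int_frontier) auto
      then obtain y where y: "y \<in> closed_segment z x" "y \<in> frontier P"
        by blast
      have "frontier P = \<Union>{F. F facet_of P}"
        using rel_boundary_of_polyhedron[OF ph] int
        by (simp add: frontier_def polyhedron_imp_closed[OF ph] rel_interior_nonempty_interior)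
      then obtain C where C: "C facet_of P" "y \<in> C"
        using y by auto
      have yb: "a C \<bullet> y = b C"
        using C ab by blast
      have xb: "a C \<bullet> x \<le> b C"
        using x C by (auto simp: G_def)
      have "interior P \<subseteq> interior {x. a C \<bullet> x \<le> b C}"
        using ab C by (intro interior_mono) blast
      then have zb: "a C \<bullet> z < b C"
        using z ab C by (auto simp: interior_halfspace_le)
      obtain u where u: "0 \<le> u" "u \<le> 1" "y = (1 - u) *\<^sub>R z + u *\<^sub>R x"
        using y by (auto simp: in_segment)
      have "u \<noteq> 1"
        using u y nx polyhedron_imp_closed[OF ph] by (auto simp: frontier_def)
      then have "(1 - u) * (a C \<bullet> z) < (1 - u) * b C"
        using u zb by simp
      moreover have "u * (a C \<bullet> x) \<le> u * b C"
        using u xb by (simp add: mult_left_mono)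
      ultimately have "a C \<bullet> y < b C"
        by (simp add: u inner_add_right algebra_simps)
      then show False
        using yb by simp
    qed
  qed
  moreover have "P \<subseteq> \<Inter>G"
    using ab by (auto simp: G_def)
  moreover have "halfspace h" if "h \<in> G" for h
    using that ab by (auto simp: G_def halfspace_def)
  moreover have "finite G" "card G \<le> card {F. F facet_of P}"
    using fin by (auto simp: G_def card_image_le)
  ultimately show thesis
    by (intro that[of G]) auto
qed

section \<open>Outer approximation with a fixed net of normals\<close>

text \<open>The net depends only on \<open>r\<close>, \<open>R\<close> and \<open>\<delta>\<close>,
  not on \<open>L\<close>. A point outside the dilate violates the dilated support inequality for
  some unit normal \<open>u\<close>. Since \<open>L\<close> extends at least \<open>r\<close> in
  direction \<open>u\<close>, the violation is too large to be absorbed by the error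
  \<open>\<delta> * r\<close> of passing to a net normal near \<open>u\<close>.\<close>

lemma normal_net_approximation:
  fixes r R \<delta> :: real
  assumes r: "0 < r" "r \<le> R" and \<delta>: "0 < \<delta>"
  shows "\<exists>N :: 'a::euclidean_space set. finite N \<and> N \<subseteq> sphere 0 1 \<and>
    (\<forall>L. compact L \<and> convex L \<and> cball 0 r \<subseteq> L \<and> L \<subseteq> cball 0 R \<longrightarrow>
       {x. \<forall>a\<in>N. \<exists>y\<in>L. a \<bullet> x \<le> a \<bullet> y} \<subseteq> (*\<^sub>R) (1 + \<delta>) ` L)"
proof -
  \<comment> \<open>The bound \<open>1/2\<close> yields \<open>norm x \<le> 3 * R\<close> below; the
    other bound then makes the error \<open>\<eta> * (R + norm x)\<close> at most
    \<open>\<delta> * r\<close>.\<close>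
  define \<eta> where "\<eta> = min (1/2) (\<delta> * r / (4 * R))"
  have R: "R > 0"
    using r by simp
  have \<eta>: "\<eta> > 0" "\<eta> \<le> 1/2" "4 * \<eta> * R \<le> \<delta> * r"
  proof -
    show "\<eta> > 0" "\<eta> \<le> 1/2"
      using r R \<delta> by (auto simp: \<eta>_def)
    have "\<eta> \<le> \<delta> * r / (4 * R)"
      by (simp add: \<eta>_def)
    then have "\<eta> * (4 * R) \<le> \<delta> * r"
      using R by (subst (asm) pos_le_divide_eq) auto
    then show "4 * \<eta> * R \<le> \<delta> * r"
      by (simp add: mult_ac)
  qed
  have "seq_compact (sphere (0::'a) 1)"
    by (simp add: compact_imp_seq_compact)
  then obtain N :: "'a set" where N: "finite N" "N \<subseteq> sphere 0 1" "sphere 0 1 \<subseteq> (\<Union>a\<in>N. ball a \<eta>)"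
    using seq_compact_imp_totally_bounded[rule_format, OF _ \<eta>(1)] by metis
  have near: "\<exists>a\<in>N. norm (u - a) \<le> \<eta>" if "norm u = 1" for u :: 'a
  proof -
    have "u \<in> (\<Union>a\<in>N. ball a \<eta>)"
      using that by (intro subsetD[OF N(3)]) simp
    then show ?thesis
      by (auto simp: dist_norm norm_minus_commute intro: less_imp_le)
  qed
  have "x \<in> (*\<^sub>R) (1 + \<delta>) ` L"
    if L: "compact L" "convex L" "cball 0 r \<subseteq> L" "L \<subseteq> cball 0 R"
      and x: "\<forall>a\<in>N. \<exists>y\<in>L. a \<bullet> x \<le> a \<bullet> y" for L and x :: 'a
  proof (rule ccontr)
    assume nx: "x \<notin> (*\<^sub>R) (1 + \<delta>) ` L"
    \<comment> \<open>The inequalities known for net normals extend to all unit vectors at the cost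
      of an error term.\<close>
    have near_bound: "\<exists>y\<in>L. u \<bullet> x \<le> u \<bullet> y + \<eta> * (R + norm x)" if u: "norm u = 1" for u
    proof -
      obtain a where a: "a \<in> N" "norm (u - a) \<le> \<eta>"
        using near[OF u] by blast
      then obtain y where y: "y \<in> L" "a \<bullet> x \<le> a \<bullet> y"
        using x by blast
      have "(u - a) \<bullet> (x - y) \<le> norm (u - a) * norm (x - y)"
        by (rule norm_cauchy_schwarz)
      also have "\<dots> \<le> \<eta> * (R + norm x)"
        using a y L \<eta> norm_triangle_ineq4[of x y] by (intro mult_mono) (auto simp: subset_iff)
      finally show ?thesis
        using y by (intro bexI[of _ y]) (simp_all add: inner_diff_left inner_diff_right)
    qed
    \<comment> \<open>The error term involves \<open>norm x\<close> itself; testing in the direction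
      of \<open>x\<close> bounds it a priori.\<close>
    have nxR: "norm x \<le> 3 * R"
    proof (cases "x = 0")
      case False
      obtain v where v: "norm v = 1" "v \<bullet> x = norm x"
        using False by (intro that[of "(1 / norm x) *\<^sub>R x"])
          (auto simp: power2_norm_eq_inner[symmetric] power2_eq_square)
      obtain y where y: "y \<in> L" "v \<bullet> x \<le> v \<bullet> y + \<eta> * (R + norm x)"
        using near_bound[OF v(1)] by blast
      have "v \<bullet> y \<le> norm y"
        using norm_cauchy_schwarz[of v y] v by simp
      moreover have "norm y \<le> R"
        using y L by auto
      moreover have "\<eta> * (R + norm x) \<le> 1/2 * (R + norm x)"
        using \<eta> R by (intro mult_right_mono) auto
      ultimately have "norm x \<le> R + 1/2 * (R + norm x)"
        using y(2) v(2) by linarith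
      then show ?thesis
        by (simp add: field_simps)
    qed (use R in auto)
    have "convex ((*\<^sub>R) (1 + \<delta>) ` L)" "closed ((*\<^sub>R) (1 + \<delta>) ` L)"
      using L by (auto intro: convex_scaling compact_imp_closed compact_scaling)
    from separating_hyperplane_closed_point[OF this nx]
    obtain w c where w: "w \<bullet> x < c" "\<And>y. y \<in> L \<Longrightarrow> (1 + \<delta>) * (w \<bullet> y) > c"
      by auto
    have "w \<noteq> 0"
      using w(1) w(2)[of 0] L r by (auto simp: subset_iff)
    \<comment> \<open>The separation puts \<open>x\<close> on the smaller side, so the outward unit
      normal is the negative of \<open>w\<close>, normalised.\<close>
    define u where "u = (- 1 / norm w) *\<^sub>R w"
    have u: "norm u = 1"
      using \<open>w \<noteq> 0\<close> by (simp add: u_def)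
    have sep: "(1 + \<delta>) * (u \<bullet> y) < u \<bullet> x" if "y \<in> L" for y
    proof -
      have "w \<bullet> x < (1 + \<delta>) * (w \<bullet> y)"
        using w that by force
      then show ?thesis
        using \<open>w \<noteq> 0\<close> by (simp add: u_def divide_simps)
    qed
    obtain y where y: "y \<in> L" "u \<bullet> x \<le> u \<bullet> y + \<eta> * (R + norm x)"
      using near_bound[OF u] by blast
    have "r *\<^sub>R u \<in> L"
      using L u r by (auto simp: subset_iff)
    have "\<eta> * (R + norm x) \<le> \<eta> * (R + 3 * R)"
      using \<eta> nxR by (intro mult_left_mono) auto
    also have "\<dots> \<le> \<delta> * r"
      using \<eta>(3) by simp
    finally have up: "u \<bullet> x \<le> u \<bullet> y + \<delta> * r"
      using y by simp
    have "\<delta> * (u \<bullet> y) < \<delta> * r"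
      using sep[OF y(1)] up by (simp add: algebra_simps)
    then have "u \<bullet> y < r"
      using \<delta> by simp
    moreover have "(1 + \<delta>) * r < u \<bullet> x"
      using sep[OF \<open>r *\<^sub>R u \<in> L\<close>] u by (simp add: power2_norm_eq_inner[symmetric])
    ultimately show False
      using up by (simp add: algebra_simps)
  qed
  note scaled = this
  show ?thesis
  proof (intro exI[of _ N] conjI allI impI subsetI)
    fix L and x :: 'a
    assume "compact L \<and> convex L \<and> cball 0 r \<subseteq> L \<and> L \<subseteq> cball 0 R"
      "x \<in> {x. \<forall>a\<in>N. \<exists>y\<in>L. a \<bullet> x \<le> a \<bullet> y}"
    then show "x \<in> (*\<^sub>R) (1 + \<delta>) ` L"
      by (elim conjE CollectE) (rule scaled)
  qed (use N in \<open>simp_all add: subset_iff\<close>)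
qed

section \<open>Affine position of a convex body between two balls\<close>

text \<open>The matrices with rows in \<open>D\<close> form a compact set on which the determinant
  is continuous. The ball in \<open>D\<close> admits \<open>s\<close> times the identity, so the
  maximum is positive.\<close>

lemma abs_det_maximal_rows:
  fixes D :: "(real^'n) set"
  assumes D: "compact D" "cball 0 s \<subseteq> D" "s > 0"
  obtains V :: "real^'n^'n" where "\<And>i. V $ i \<in> D" "det V \<noteq> 0"
    "\<And>W :: real^'n^'n. (\<And>i. W $ i \<in> D) \<Longrightarrow> \<bar>det W\<bar> \<le> \<bar>det V\<bar>"
proof -
  define T where "T = {W :: real^'n^'n. \<forall>i. W $ i \<in> D}"
  have "closed T"
  proof -
    have "T = (\<Inter>i. (\<lambda>W. W $ i) -` D)"
      by (auto simp: T_def)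
    then show ?thesis
      using compact_imp_closed[OF D(1)] by (auto intro!: closed_INT continuous_closed_vimage continuous_intros)
  qed
  moreover have "bounded T"
  proof -
    obtain B where B: "\<And>x. x \<in> D \<Longrightarrow> norm x \<le> B"
      using compact_imp_bounded[OF D(1)] bounded_iff by blast
    have "norm W \<le> (\<Sum>i\<in>(UNIV::'n set). B)" if "W \<in> T" for W
    proof -
      have "norm W \<le> (\<Sum>i\<in>UNIV. norm (W $ i))"
        unfolding norm_vec_def by (intro L2_set_le_sum) auto
      also have "\<dots> \<le> (\<Sum>i\<in>(UNIV::'n set). B)"
        using that B by (intro sum_mono) (auto simp: T_def)
      finally show ?thesis .
    qed
    then show ?thesis
      using bounded_iff by blast
  qed
  ultimately have "compact T"
    by (simp add: compact_eq_bounded_closed)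
  have diag: "(\<chi> i j. if i = j then s else 0) \<in> T"
  proof -
    have "(\<chi> j. if i = j then s else 0) = s *\<^sub>R axis i 1" for i :: 'n
      by (auto simp: vec_eq_iff axis_def)
    then show ?thesis
      using D by (auto simp: T_def subset_iff)
  qed
  have "continuous_on T (\<lambda>W. \<bar>det W\<bar>)"
    unfolding det_def by (intro continuous_intros)
  then obtain V where V: "V \<in> T" "\<And>W. W \<in> T \<Longrightarrow> \<bar>det W\<bar> \<le> \<bar>det V\<bar>"
    using continuous_attains_sup[OF \<open>compact T\<close>, of "\<lambda>W. \<bar>det W\<bar>"] diag by blast
  have "det (\<chi> i j :: 'n. if i = j then s else 0) = s ^ CARD('n)"
    by (subst det_diagonal) auto
  then have "\<bar>det V\<bar> > 0"
    using V(2)[OF diag] D(3) by (smt (verit) zero_less_power)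
  then show thesis
    using V by (intro that[of V]) (auto simp: T_def)
qed

text \<open>A basis of differences of points of \<open>K\<close> with maximal determinant is, by Cramer's rule, an
  Auerbach-type basis: in its coordinates \<open>K\<close> has diameter at most \<open>1\<close> in the sup norm, while
  averaging the segments of \<open>K\<close> that realise the basis vectors yields a cube of side \<open>1 / d\<close>
  in \<open>K\<close>.\<close>

lemma convex_body_position:
  fixes K :: "(real^'d) set"
  assumes K: "compact K" "convex K" "interior K \<noteq> {}"
  obtains f :: "real^'d \<Rightarrow> real^'d" and p where "linear f" "bij f"
    "(\<lambda>c. p + f c) ` cball 0 (1 / (2 * real CARD('d))) \<subseteq> K"
    "K \<subseteq> (\<lambda>c. p + f c) ` cball 0 (real CARD('d))"
proof -
  define D where "D = {x - y | x y. x \<in> K \<and> y \<in> K}"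
  have cD: "compact D"
    using compact_differences[OF K(1) K(1)] by (simp add: D_def)
  obtain q s where s: "s > 0" "cball q s \<subseteq> K"
    using K(3) by (meson ex_in_conv mem_interior_cball)
  have "cball 0 s \<subseteq> D"
  proof
    fix x :: "real^'d" assume "x \<in> cball 0 s"
    then have "q + x \<in> K" "q \<in> K"
      using s by (auto simp: subset_iff dist_norm)
    moreover have "x = (q + x) - q"
      by simp
    ultimately show "x \<in> D"
      unfolding D_def by blast
  qed
  then obtain V :: "real^'d^'d" where V: "\<And>i. V $ i \<in> D" "det V \<noteq> 0"
    and max: "\<And>W :: real^'d^'d. (\<And>i. W $ i \<in> D) \<Longrightarrow> \<bar>det W\<bar> \<le> \<bar>det V\<bar>"
    using abs_det_maximal_rows[OF cD _ s(1)] by blast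
  define f where "f c = transpose V *v c" for c
  have f_sum: "f c = (\<Sum>i\<in>UNIV. (c $ i) *\<^sub>R (V $ i))" for c
    by (simp add: f_def vec_eq_iff matrix_vector_mult_def transpose_def mult.commute)
  have dT: "det (transpose V) \<noteq> 0"
    using V by (simp add: det_transpose)
  have "linear f"
    unfolding f_def by (rule matrix_vector_mul_linear)
  have sol: "\<exists>c. (\<forall>i. \<bar>c $ i\<bar> \<le> 1) \<and> x = f c" if x: "x \<in> D" for x
  proof -
    define c where "c = (\<chi> k. det (\<chi> i j. if j = k then x $ i else transpose V $ i $ j) / det (transpose V))"
    have "x = f c"
      using cramer[OF dT, of c x] by (simp add: f_def c_def)
    moreover have "\<bar>c $ k\<bar> \<le> 1" for k
    proof -
      \<comment> \<open>The numerator in Cramer's rule is the determinant of \<open>V\<close> with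
        row \<open>k\<close> replaced by \<open>x\<close>, a competitor in the maximisation.\<close>
      have "(\<chi> i j. if j = k then x $ i else transpose V $ i $ j) = transpose (\<chi> j. if j = k then x else V $ j)"
        by (simp add: vec_eq_iff transpose_def)
      then have "\<bar>c $ k\<bar> = \<bar>det (\<chi> j. if j = k then x else V $ j)\<bar> / \<bar>det V\<bar>"
        by (simp add: c_def det_transpose)
      also have "\<dots> \<le> 1"
        using max[of "\<chi> j. if j = k then x else V $ j"] V x by auto
      finally show ?thesis .
    qed
    ultimately show ?thesis
      by blast
  qed
  have "bij f"
  proof -
    have "surj f"
      unfolding surj_def f_def by (intro allI exI) (rule sym, rule cramer[OF dT, THEN iffD2, OF refl])
    then show ?thesis
      using \<open>linear f\<close> linear_surjective_imp_injective[of f] by (auto simp: bij_def)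
  qed
  have "\<exists>x y. x \<in> K \<and> y \<in> K \<and> V $ i = x - y" for i
    using V(1)[of i] by (auto simp: D_def)
  then obtain X Y where XY: "\<And>i. X i \<in> K" "\<And>i. Y i \<in> K" "\<And>i. V $ i = X i - Y i"
    by metis
  define d where "d = real CARD('d)"
  have d: "d > 0"
    by (simp add: d_def)
  \<comment> \<open>The centre is the average of the midpoints of the segments from
    \<open>Y i\<close> to \<open>X i\<close>.\<close>
  define p where "p = (\<Sum>i\<in>UNIV. (1 / d) *\<^sub>R ((1/2) *\<^sub>R X i + (1/2) *\<^sub>R Y i))"
  have avg: "(\<Sum>i\<in>(UNIV::'d set). (1 / d) *\<^sub>R z i) \<in> K" if "\<And>i. z i \<in> K" for z
    using that K by (intro convex_sum) (auto simp: d_def)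
  have inner: "p + f c \<in> K" if c: "norm c \<le> 1 / (2 * d)" for c
  proof -
    \<comment> \<open>Moving by \<open>c $ i\<close> along \<open>V $ i\<close> shifts the weight of
      \<open>X i\<close> in its segment by \<open>d * c $ i\<close>, since each segment enters the
      average with factor \<open>1 / d\<close>. A shift of at most \<open>1/2\<close> keeps both
      weights nonnegative.\<close>
    have cb: "\<bar>d * c $ i\<bar> \<le> 1/2" for i
    proof -
      have "\<bar>c $ i\<bar> \<le> 1 / (2 * d)"
        using component_le_norm_cart[of c i] c by linarith
      then have "d * \<bar>c $ i\<bar> \<le> d * (1 / (2 * d))"
        using d by (intro mult_left_mono) auto
      then show ?thesis
        using d by (simp add: abs_mult)
    qed
    have "(1/2 + d * c $ i) *\<^sub>R X i + (1/2 - d * c $ i) *\<^sub>R Y i \<in> K" for i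
      using cb[of i] XY K(2) by (intro convexD) (auto simp: abs_le_iff)
    then have "(\<Sum>i\<in>UNIV. (1 / d) *\<^sub>R ((1/2 + d * c $ i) *\<^sub>R X i + (1/2 - d * c $ i) *\<^sub>R Y i)) \<in> K"
      by (rule avg)
    moreover have "(1 / d) *\<^sub>R ((1/2 + d * c $ i) *\<^sub>R X i + (1/2 - d * c $ i) *\<^sub>R Y i)
       = (1 / d) *\<^sub>R ((1/2) *\<^sub>R X i + (1/2) *\<^sub>R Y i) + c $ i *\<^sub>R V $ i" for i
      using d by (simp add: XY(3) algebra_simps)
    ultimately show ?thesis
      by (simp add: p_def f_sum sum.distrib)
  qed
  have "f 0 = 0"
    by (simp add: f_def)
  then have "p \<in> K"
    using inner[of 0] d by simp
  have outer: "x \<in> (\<lambda>c. p + f c) ` cball 0 d" if "x \<in> K" for x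
  proof -
    have "x - p \<in> D"
      using that \<open>p \<in> K\<close> by (auto simp: D_def)
    then obtain c where c: "\<And>i. \<bar>c $ i\<bar> \<le> 1" "x - p = f c"
      using sol by blast
    have "norm c \<le> (\<Sum>i\<in>UNIV. \<bar>c $ i\<bar>)"
      by (rule norm_le_l1_cart)
    also have "\<dots> \<le> (\<Sum>i\<in>(UNIV::'d set). 1)"
      using c by (intro sum_mono) auto
    finally have "norm c \<le> d"
      by (simp add: d_def)
    then show ?thesis
      using c(2) by (intro image_eqI[of _ _ c]) (auto simp: algebra_simps)
  qed
  show thesis
    using \<open>linear f\<close> \<open>bij f\<close> inner outer by (intro that[of f p]) (auto simp: d_def)
qed

section \<open>One number of halfspaces for all convex bodies\<close>

text \<open>The net is chosen before \<open>K\<close>, so its size serves as \<open>n\<close>. It is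
  applied to the body in normalised coordinates, and the inclusion is carried back to
  \<open>K\<close>. There it compares \<open>C\<close> with a dilate of itself, so the determinant
  of the coordinate change never enters.\<close>

lemma ex_uniform_outer_approximation:
  fixes \<epsilon> :: real
  assumes "\<epsilon> > 0"
  shows "\<exists>n. \<forall>K :: (real^'d) set. convex K \<and> 0 < emeasure lebesgue K \<and> emeasure lebesgue K < \<infinity> \<longrightarrow>
    (\<exists>G. finite G \<and> card G \<le> n \<and> (\<forall>h\<in>G. halfspace h) \<and> K \<subseteq> \<Inter>G \<and>
         emeasure lebesgue (\<Inter>G) \<le> ennreal (1 + \<epsilon>) * emeasure lebesgue K)"
proof -
  define d where "d = real CARD('d)"
  have d: "d \<ge> 1"
    by (simp add: d_def Suc_le_eq)
  obtain \<delta> where \<delta>: "\<delta> > 0" "(1 + \<delta>) ^ CARD('d) \<le> 1 + \<epsilon>"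
  proof -
    have "((\<lambda>x. (1 + x) ^ CARD('d)) \<longlongrightarrow> (1 + 0) ^ CARD('d)) (at_right (0::real))"
      by (intro tendsto_intros)
    then have "eventually (\<lambda>x. (1 + x) ^ CARD('d) < 1 + \<epsilon>) (at_right (0::real))"
      using assms by (intro order_tendstoD(2)) auto
    moreover have "eventually (\<lambda>x. x > 0) (at_right (0::real))"
      by (rule eventually_at_right_less)
    ultimately have "eventually (\<lambda>x. x > 0 \<and> (1 + x) ^ CARD('d) \<le> 1 + \<epsilon>) (at_right (0::real))"
      by eventually_elim auto
    then show thesis
      using eventually_happens that trivial_limit_at_right_real by blast
  qed
  have rR: "0 < 1 / (2 * d)" "1 / (2 * d) \<le> d"
  proof -
    show "0 < 1 / (2 * d)"
      using d by simp
    have "1 / (2 * d) \<le> 1"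
      using d by simp
    then show "1 / (2 * d) \<le> d"
      using d by (rule order_trans)
  qed
  obtain N :: "(real^'d) set" where N: "finite N" "N \<subseteq> sphere 0 1"
    and net: "\<forall>L. compact L \<and> convex L \<and> cball 0 (1 / (2 * d)) \<subseteq> L \<and> L \<subseteq> cball 0 d \<longrightarrow>
       {x. \<forall>a\<in>N. \<exists>y\<in>L. a \<bullet> x \<le> a \<bullet> y} \<subseteq> (*\<^sub>R) (1 + \<delta>) ` L"
    by (rule exE[OF normal_net_approximation[OF rR \<delta>(1), where 'a = "real^'d"]], elim conjE) (rule that)
  have "\<exists>G. finite G \<and> card G \<le> card N \<and> (\<forall>h\<in>G. halfspace h) \<and> K \<subseteq> \<Inter>G \<and>
         emeasure lebesgue (\<Inter>G) \<le> ennreal (1 + \<epsilon>) * emeasure lebesgue K"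
    if K: "convex K" "0 < emeasure lebesgue K" "emeasure lebesgue K < \<infinity>" for K :: "(real^'d) set"
  proof -
    define C where "C = closure K"
    have vol_C: "emeasure lebesgue C = emeasure lebesgue K"
      using emeasure_closure_convex[OF K(1)] by (simp add: C_def)
    have C: "compact C" "convex C" "K \<subseteq> C"
      using bounded_convex_finite_emeasure[OF K] K(1)
      by (simp_all add: C_def convex_closure closure_subset)
    then have int_C: "interior C \<noteq> {}"
      using K(2) by (simp add: emeasure_convex_pos_iff[symmetric] vol_C)
    obtain f :: "real^'d \<Rightarrow> real^'d" and p where f: "linear f" "bij f"
      and inner: "(\<lambda>c. p + f c) ` cball 0 (1 / (2 * d)) \<subseteq> C"
      and outer: "C \<subseteq> (\<lambda>c. p + f c) ` cball 0 d"
      unfolding d_def using convex_body_position[OF C(1,2) int_C] by blast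
    define g where "g = inv f"
    have fg: "f (g x) = x" "g (f x) = x" for x
      using f(2) by (simp_all add: g_def bij_def surj_f_inv_f inv_f_f)
    have "linear g"
      unfolding g_def using f by (metis bij_is_inj bij_is_surj inj_linear_imp_inv_linear)
    define L where "L = (\<lambda>c. p + f c) -` C"
    have "cball 0 (1 / (2 * d)) \<subseteq> L"
      using inner by (auto simp: L_def)
    moreover have L_out: "L \<subseteq> cball 0 d"
    proof
      fix c assume "c \<in> L"
      then have "p + f c \<in> (\<lambda>c. p + f c) ` cball 0 d"
        using outer by (auto simp: L_def)
      then obtain c' where "f c = f c'" "c' \<in> cball 0 d"
        by auto
      then show "c \<in> cball 0 d"
        by (metis fg(2))
    qed
    moreover have "convex L"
    proof (rule convexI)
      fix x y u v assume xy: "x \<in> L" "y \<in> L" and uv: "0 \<le> u" "0 \<le> v" "u + v = (1::real)"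
      have "u *\<^sub>R (p + f x) + v *\<^sub>R (p + f y) \<in> C"
        using xy uv C(2) by (intro convexD) (auto simp: L_def)
      also have "u *\<^sub>R (p + f x) + v *\<^sub>R (p + f y) = (u + v) *\<^sub>R p + f (u *\<^sub>R x + v *\<^sub>R y)"
        using f(1) by (simp add: linear_add linear_scale algebra_simps)
      finally show "u *\<^sub>R x + v *\<^sub>R y \<in> L"
        using uv by (simp add: L_def)
    qed
    moreover have "compact L"
    proof -
      have "continuous (at c) f" for c
        using f(1) by (simp add: linear_continuous_at linear_conv_bounded_linear)
      then have "closed L"
        unfolding L_def using C(1)
        by (intro continuous_closed_vimage compact_imp_closed continuous_add continuous_const)
      moreover have "bounded L"
        using L_out bounded_cball bounded_subset by blast
      ultimately show ?thesis
        by (simp add: compact_eq_bounded_closed)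
    qed
    ultimately have net_L: "{x. \<forall>a\<in>N. \<exists>y\<in>L. a \<bullet> x \<le> a \<bullet> y} \<subseteq> (*\<^sub>R) (1 + \<delta>) ` L"
      by (intro net[rule_format] conjI)
    \<comment> \<open>The net lives in the normalised coordinates; the adjoint of \<open>g\<close>
      transports its normals to the space of \<open>K\<close>.\<close>
    define n where "n a = adjoint g a" for a
    have n: "n a \<bullet> x = a \<bullet> g x" for a x
      using \<open>linear g\<close> by (simp add: n_def adjoint_clauses)
    have n0: "n a \<noteq> 0" if "a \<in> N" for a
    proof
      assume "n a = 0"
      then have "a \<bullet> g (f a) = 0"
        using n[of a "f a"] by simp
      then show False
        using that N by (auto simp: fg)
    qed
    have "C \<noteq> {}"
      using int_C interior_subset by blast
    have "\<exists>y\<in>C. \<forall>x\<in>C. n a \<bullet> x \<le> n a \<bullet> y" for a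
      using C(1) \<open>C \<noteq> {}\<close> by (intro continuous_attains_sup) (auto intro!: continuous_intros)
    then obtain y where y: "\<And>a. y a \<in> C" "\<And>a x. x \<in> C \<Longrightarrow> n a \<bullet> x \<le> n a \<bullet> y a"
      by metis
    define G where "G = (\<lambda>a. {x. n a \<bullet> x \<le> n a \<bullet> y a}) ` N"
    \<comment> \<open>The right-hand side is the dilate of \<open>C\<close> about \<open>p\<close>
      by the factor \<open>1 + \<delta>\<close>.\<close>
    have "\<Inter>G \<subseteq> (\<lambda>x. (1 + \<delta>) *\<^sub>R x + (- \<delta>) *\<^sub>R p) ` C"
    proof
      fix x assume x: "x \<in> \<Inter>G"
      have "\<exists>z\<in>L. a \<bullet> g (x - p) \<le> a \<bullet> z" if "a \<in> N" for a
      proof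
        show "g (y a - p) \<in> L"
          using y by (simp add: L_def fg)
        show "a \<bullet> g (x - p) \<le> a \<bullet> g (y a - p)"
          using x that by (simp add: G_def n[symmetric] inner_diff_right)
      qed
      then obtain z where z: "z \<in> L" "g (x - p) = (1 + \<delta>) *\<^sub>R z"
        using net_L by blast
      have "x - p = (1 + \<delta>) *\<^sub>R f z"
        using z f(1) by (metis fg(1) linear_scale)
      then have "x = (1 + \<delta>) *\<^sub>R (p + f z) + (- \<delta>) *\<^sub>R p"
        by (simp add: algebra_simps)
      then show "x \<in> (\<lambda>x. (1 + \<delta>) *\<^sub>R x + (- \<delta>) *\<^sub>R p) ` C"
        using z by (auto simp: L_def)
    qed
    then have "emeasure lebesgue (\<Inter>G) \<le> emeasure lebesgue ((\<lambda>x. (1 + \<delta>) *\<^sub>R x + (- \<delta>) *\<^sub>R p) ` C)"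
      using C(1) by (intro emeasure_mono)
        (auto intro!: lmeasurable_compact fmeasurableD compact_continuous_image continuous_intros)
    also have "\<dots> = ennreal ((1 + \<delta>) ^ CARD('d)) * emeasure lebesgue C"
      using emeasure_lebesgue_affine[of "1 + \<delta>" "(- \<delta>) *\<^sub>R p" C] \<delta>(1)
      by (simp add: ennreal_power)
    also have "\<dots> \<le> ennreal (1 + \<epsilon>) * emeasure lebesgue K"
      unfolding vol_C using \<delta>(2) by (intro mult_right_mono) (auto simp: ennreal_leI)
    finally have vol: "emeasure lebesgue (\<Inter>G) \<le> ennreal (1 + \<epsilon>) * emeasure lebesgue K" .
    have "K \<subseteq> \<Inter>G"
      using y C(3) by (auto simp: G_def)
    moreover have "\<forall>h\<in>G. halfspace h"
      using n0 by (auto simp: G_def halfspace_def)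
    moreover have "finite G" "card G \<le> card N"
      using N(1) by (auto simp: G_def card_image_le)
    ultimately show ?thesis
      using vol by blast
  qed
  then show ?thesis
    by blast
qed

section \<open>Compactness: a volume gap for families of \<open>m\<close> halfspaces\<close>

lemma common_convergent_subsequence:
  fixes a :: "nat \<Rightarrow> nat \<Rightarrow> 'a::heine_borel"
  assumes "\<And>k i. i < m \<Longrightarrow> a k i \<in> S" "compact S"
  shows "\<exists>r. strict_mono r \<and> (\<forall>i<m. \<exists>l\<in>S. (\<lambda>k. a (r k) i) \<longlonglongrightarrow> l)"
  using assms(1)
proof (induction m)
  case 0
  then show ?case
    using strict_mono_id by auto
next
  case (Suc m)
  then obtain r where r: "strict_mono r" "\<forall>i<m. \<exists>l\<in>S. (\<lambda>k. a (r k) i) \<longlonglongrightarrow> l"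
    by (metis less_Suc_eq)
  have "\<forall>k. a (r k) m \<in> S"
    using Suc.prems by simp
  then obtain l s where l: "l \<in> S" "strict_mono s" "((\<lambda>k. a (r k) m) \<circ> s) \<longlonglongrightarrow> l"
    using \<open>compact S\<close> unfolding compact_def by metis
  have "\<exists>l\<in>S. (\<lambda>k. a ((r \<circ> s) k) i) \<longlonglongrightarrow> l" if i: "i < Suc m" for i
  proof (cases "i = m")
    case True
    then show ?thesis
      using l by (auto simp: o_def)
  next
    case False
    then obtain l' where "l' \<in> S" "(\<lambda>k. a (r k) i) \<longlonglongrightarrow> l'"
      using r i by (metis less_SucE)
    then show ?thesis
      using LIMSEQ_subseq_LIMSEQ[OF _ l(2), of "\<lambda>k. a (r k) i" l'] by (auto simp: o_def)
  qed
  then show ?case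
    using r(1) l(2) by (intro exI[of _ "r \<circ> s"] conjI strict_mono_o) auto
qed

text \<open>The minimal volume of an intersection of at most \<open>m\<close> halfspaces containing \<open>K\<close> is attained:
  the halfspaces may be taken to support \<open>K\<close>, so they are determined by their unit normals, and the
  volume is lower semicontinuous in these.\<close>

lemma emeasure_Inter_halfspaces_gap:
  fixes K :: "'a::euclidean_space set"
  assumes K: "bounded K" "K \<noteq> {}" and c: "c < \<infinity>"
    and gt: "\<And>G. finite G \<Longrightarrow> card G \<le> m \<Longrightarrow> \<forall>h\<in>G. halfspace h \<Longrightarrow> K \<subseteq> \<Inter>G \<Longrightarrow>
       c < emeasure lebesgue (\<Inter>G)"
  shows "\<exists>V>c. \<forall>G. finite G \<and> card G \<le> m \<and> (\<forall>h\<in>G. halfspace h) \<and> K \<subseteq> \<Inter>G \<longrightarrow>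
       V \<le> emeasure lebesgue (\<Inter>G)"
proof (rule ccontr)
  assume no_gap: "\<not> ?thesis"
  \<comment> \<open>\<open>s\<close> is the support function of \<open>K\<close>, and
    \<open>P a\<close> below is cut out by the supporting halfspaces with normals
    \<open>a i\<close>.\<close>
  define s where "s u = (SUP y\<in>K. u \<bullet> y)" for u
  have bdd: "bdd_above ((\<bullet>) u ` K)" for u
    using K(1) by (intro bounded_imp_bdd_above bounded_linear_image bounded_linear_inner_right)
  have s_upper: "u \<bullet> y \<le> s u" if "y \<in> K" for u y
    unfolding s_def using that bdd by (intro cSUP_upper) auto
  define P where "P a = {x. \<forall>i<m. a i \<bullet> x \<le> s (a i)}" for a :: "nat \<Rightarrow> 'a"
  have P_halfspaces: "P a = \<Inter>((\<lambda>i. {x. a i \<bullet> x \<le> s (a i)}) ` {..<m})" for a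
    by (auto simp: P_def)
  have P_sets: "P a \<in> sets lebesgue" for a
    unfolding P_halfspaces by (intro sets_lebesgue_convex convex_INT convex_halfspace_le)
  have supporting: "\<exists>a. (\<forall>i<m. norm (a i) = 1) \<and> P a \<subseteq> \<Inter>G"
    if G: "finite G" "card G \<le> m" "\<forall>h\<in>G. halfspace h" "K \<subseteq> \<Inter>G" for G
  proof -
    obtain e where e: "bij_betw e {0..<card G} G"
      using ex_bij_betw_nat_finite[OF G(1)] by blast
    have "\<exists>v. norm v = 1 \<and> (i < card G \<longrightarrow> {x. v \<bullet> x \<le> s v} \<subseteq> e i)" for i
    proof (cases "i < card G")
      case True
      then have "e i \<in> G"
        using e by (auto simp: bij_betw_def)
      then obtain w b where w: "w \<noteq> 0" "e i = {x. w \<bullet> x \<le> b}"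
        using G(3) unfolding halfspace_def by blast
      define v where "v = (1 / norm w) *\<^sub>R w"
      have "K \<subseteq> e i"
        using G(4) \<open>e i \<in> G\<close> by blast
      then have "s v \<le> b / norm w"
        unfolding s_def using w K(2) by (intro cSUP_least) (auto simp: v_def divide_right_mono)
      moreover have "v \<bullet> x = (w \<bullet> x) / norm w" for x
        by (simp add: v_def)
      ultimately have "(w \<bullet> x) / norm w \<le> b / norm w" if "v \<bullet> x \<le> s v" for x
        using that by simp
      then have "{x. v \<bullet> x \<le> s v} \<subseteq> e i"
        using w(1) by (auto simp: w(2) divide_le_cancel)
      moreover have "norm v = 1"
        using w(1) by (simp add: v_def)
      ultimately show ?thesis
        by blast
    next
      \<comment> \<open>Surplus indices receive an arbitrary unit vector: a further supporting
        halfspace only shrinks \<open>P a\<close>.\<close>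
      case False
      then show ?thesis
        using vector_choose_size[of 1, where 'a = 'a] by auto
    qed
    then obtain a where a: "\<And>i. norm (a i) = 1" "\<And>i. i < card G \<Longrightarrow> {x. a i \<bullet> x \<le> s (a i)} \<subseteq> e i"
      by metis
    have "P a \<subseteq> h" if "h \<in> G" for h
    proof -
      have "h \<in> e ` {0..<card G}"
        using that e by (simp add: bij_betw_def)
      then obtain i where "i \<in> {0..<card G}" "h = e i"
        by (rule imageE)
      then show ?thesis
        using a(2)[of i] G(2) by (auto simp: P_def)
    qed
    then show ?thesis
      using a(1) by blast
  qed
  have "\<exists>a. (\<forall>i<m. norm (a i) = 1) \<and> emeasure lebesgue (P a) < V" if V: "V > c" for V
  proof -
    obtain G where G: "finite G" "card G \<le> m" "\<forall>h\<in>G. halfspace h" "K \<subseteq> \<Inter>G"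
      "emeasure lebesgue (\<Inter>G) < V"
      using no_gap V by (meson not_le)
    obtain a where a: "\<forall>i<m. norm (a i) = 1" "P a \<subseteq> \<Inter>G"
      using supporting[OF G(1-4)] by blast
    have "emeasure lebesgue (P a) \<le> emeasure lebesgue (\<Inter>G)"
      using a G by (intro emeasure_mono sets_lebesgue_convex convex_Inter)
        (auto intro: halfspace_imp_convex)
    then show ?thesis
      using a G(5) by (meson le_less_trans)
  qed
  moreover have "c < c + ennreal (1 / real (Suc k))" for k
    using c by (simp add: ennreal_add_left_cancel_less less_top)
  ultimately have "\<exists>a. (\<forall>i<m. norm (a i) = 1) \<and> emeasure lebesgue (P a) < c + ennreal (1 / real (Suc k))" for k
    by blast
  then obtain A where A: "\<And>k i. i < m \<Longrightarrow> norm (A k i) = 1"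
    and A_vol: "\<And>k. emeasure lebesgue (P (A k)) < c + ennreal (1 / real (Suc k))"
    by metis
  have "\<exists>r. strict_mono r \<and> (\<forall>i<m. \<exists>l\<in>sphere (0::'a) 1. (\<lambda>k. A (r k) i) \<longlonglongrightarrow> l)"
    using A by (intro common_convergent_subsequence) auto
  then obtain r where r: "strict_mono r" "\<forall>i<m. \<exists>l\<in>sphere (0::'a) 1. (\<lambda>k. A (r k) i) \<longlonglongrightarrow> l"
    by blast
  then obtain a where a: "\<And>i. i < m \<Longrightarrow> norm (a i) = 1" "\<And>i. i < m \<Longrightarrow> (\<lambda>k. A (r k) i) \<longlonglongrightarrow> a i"
    by (metis mem_sphere_0)
  have a_nz: "a i \<noteq> 0" if "i < m" for i
    using a(1)[OF that] by auto
  define U where "U = {x. \<forall>i<m. a i \<bullet> x < s (a i)}"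
  \<comment> \<open>The increasing union of the \<open>B j\<close> is the lower limit of the sets
    \<open>P (A (r k))\<close>. Each \<open>B j\<close> lies in all late members of that sequence,
    whose volumes have upper bounds tending to \<open>c\<close>.\<close>
  define B where "B j = (\<Inter>k\<in>{j..}. P (A (r k)))" for j
  have B_sets: "B j \<in> sets lebesgue" for j
    unfolding B_def P_halfspaces by (intro sets_lebesgue_convex convex_INT convex_halfspace_le)
  have B_vol: "emeasure lebesgue (B j) \<le> c" for j
  proof -
    have lim: "(\<lambda>k. c + ennreal (1 / real (Suc k))) \<longlonglongrightarrow> c + ennreal 0"
      using LIMSEQ_Suc[OF lim_1_over_n] by (intro tendsto_intros) simp_all
    have "emeasure lebesgue (B j) \<le> c + ennreal (1 / real (Suc k))" if "k \<ge> j" for k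
    proof -
      have "emeasure lebesgue (B j) \<le> emeasure lebesgue (P (A (r k)))"
        using that by (intro emeasure_mono P_sets) (auto simp: B_def)
      also have "\<dots> \<le> c + ennreal (1 / real (Suc (r k)))"
        using A_vol less_imp_le by blast
      also have "\<dots> \<le> c + ennreal (1 / real (Suc k))"
        using seq_suble[OF r(1), of k] by (intro add_left_mono ennreal_leI divide_left_mono) auto
      finally show ?thesis .
    qed
    then have "emeasure lebesgue (B j) \<le> c + ennreal 0"
      by (intro tendsto_lowerbound[OF lim]) (auto simp: eventually_sequentially)
    then show ?thesis
      by simp
  qed
  have U_B: "U \<subseteq> (\<Union>j. B j)"
  proof
    fix x assume x: "x \<in> U"
    have "\<forall>\<^sub>F k in sequentially. A (r k) i \<bullet> x \<le> s (A (r k) i)" if i: "i < m" for i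
    proof -
      have "a i \<bullet> x < s (a i)"
        using x i by (simp add: U_def)
      \<comment> \<open>One point \<open>y\<close> of \<open>K\<close> witnesses the strict
        inequality, and it remains a witness for all normals close to \<open>a i\<close>.\<close>
      then obtain y where y: "y \<in> K" "a i \<bullet> x < a i \<bullet> y"
        unfolding s_def using less_cSUP_iff[OF K(2) bdd] by blast
      have "(\<lambda>k. A (r k) i \<bullet> (y - x)) \<longlonglongrightarrow> a i \<bullet> (y - x)"
        using a(2)[OF i] by (intro tendsto_intros)
      then have "\<forall>\<^sub>F k in sequentially. 0 < A (r k) i \<bullet> (y - x)"
        by (rule order_tendstoD(1)) (use y(2) in \<open>simp add: inner_diff_right\<close>)
      then show ?thesis
      proof eventually_elim
        case (elim k)
        then show ?case
          using s_upper[OF y(1), of "A (r k) i"] by (simp add: inner_diff_right)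
      qed
    qed
    then have "\<forall>\<^sub>F k in sequentially. \<forall>i\<in>{..<m}. A (r k) i \<bullet> x \<le> s (A (r k) i)"
      by (intro eventually_ball_finite) auto
    then obtain j where "\<forall>k\<ge>j. \<forall>i\<in>{..<m}. A (r k) i \<bullet> x \<le> s (A (r k) i)"
      by (auto simp: eventually_sequentially)
    then show "x \<in> (\<Union>j. B j)"
      by (auto simp: B_def P_def)
  qed
  \<comment> \<open>Passing from strict to weak inequalities adds only points on \<open>m\<close>
    hyperplanes, a null set.\<close>
  have P_U: "P a \<subseteq> U \<union> (\<Union>i\<in>{..<m}. {x. a i \<bullet> x = s (a i)})"
  proof
    fix x assume "x \<in> P a"
    then have "x \<in> U" if "\<forall>i<m. a i \<bullet> x \<noteq> s (a i)"
      using that unfolding P_def U_def by (simp add: less_le)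
    then show "x \<in> U \<union> (\<Union>i\<in>{..<m}. {x. a i \<bullet> x = s (a i)})"
      by auto
  qed
  have "P a \<subseteq> (\<Union>j. B j) \<union> (\<Union>i\<in>{..<m}. {x. a i \<bullet> x = s (a i)})"
    by (rule order_trans[OF P_U Un_mono[OF U_B order_refl]])
  moreover have null: "(\<Union>i\<in>{..<m}. {x. a i \<bullet> x = s (a i)}) \<in> null_sets lebesgue"
  proof (intro null_sets.finite_UN)
    fix i assume "i \<in> {..<m}"
    then have "a i \<noteq> 0"
      using a_nz by simp
    then show "{x. a i \<bullet> x = s (a i)} \<in> null_sets lebesgue"
      by (simp add: negligible_iff_null_sets[symmetric] negligible_hyperplane)
  qed simp
  ultimately have "emeasure lebesgue (P a) \<le>
      emeasure lebesgue ((\<Union>j. B j) \<union> (\<Union>i\<in>{..<m}. {x. a i \<bullet> x = s (a i)}))"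
    using B_sets by (intro emeasure_mono) auto
  also have "\<dots> = emeasure lebesgue (\<Union>j. B j)"
    using B_sets null by (intro emeasure_Un_null_set) auto
  also have "\<dots> = (SUP j. emeasure lebesgue (B j))"
    using B_sets by (intro SUP_emeasure_incseq[symmetric]) (auto simp: incseq_def B_def)
  also have "\<dots> \<le> c"
    using B_vol by (intro SUP_least)
  finally have "emeasure lebesgue (P a) \<le> c" .
  \<comment> \<open>The limit halfspaces are themselves an admissible family, which contradicts the
    bound just obtained.\<close>
  moreover have "c < emeasure lebesgue (P a)"
    unfolding P_halfspaces
  proof (rule gt)
    show "card ((\<lambda>i. {x. a i \<bullet> x \<le> s (a i)}) ` {..<m}) \<le> m"
      by (rule order_trans[OF card_image_le]) simp_all
    show "\<forall>h\<in>(\<lambda>i. {x. a i \<bullet> x \<le> s (a i)}) ` {..<m}. halfspace h"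
    proof (intro ballI, elim imageE)
      fix h i assume "h = {x. a i \<bullet> x \<le> s (a i)}" "i \<in> {..<m}"
      then show "halfspace h"
        unfolding halfspace_def using a_nz[of i] by blast
    qed
    show "K \<subseteq> \<Inter>((\<lambda>i. {x. a i \<bullet> x \<le> s (a i)}) ` {..<m})"
      using s_upper by auto
  qed simp
  ultimately show False
    by simp
qed

section \<open>\<open>n_star\<close> is attained and at least 2\<close>

lemma convex_Inter_halfspaces: "(\<And>h. h \<in> G \<Longrightarrow> halfspace h) \<Longrightarrow> convex (\<Inter>G)"
  by (intro convex_Inter) (auto intro: halfspace_imp_convex)

lemma bounded_Inter_halfspaces:
  fixes K :: "'a::euclidean_space set"
  assumes "\<And>h. h \<in> G \<Longrightarrow> halfspace h" "K \<subseteq> \<Inter>G" "0 < emeasure lebesgue K"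
    "emeasure lebesgue (\<Inter>G) < \<infinity>"
  shows "bounded (\<Inter>G)"
proof (rule bounded_convex_finite_emeasure)
  show "convex (\<Inter>G)"
    using assms(1) by (rule convex_Inter_halfspaces)
  then show "0 < emeasure lebesgue (\<Inter>G)"
    using assms(2,3) by (meson emeasure_mono less_le_trans sets_lebesgue_convex)
qed fact

text \<open>The uniform bound on the number of halfspaces shows that some number is admissible, so
  the least one is as well. Finite volume makes the intersection bounded, hence a polytope.\<close>

lemma n_star_approximation:
  fixes K :: "(real^'d) set"
  assumes "\<epsilon> > 0" "convex K" "0 < emeasure lebesgue K" "emeasure lebesgue K < \<infinity>"
  shows "\<exists>P. polytope P \<and> K \<subseteq> P \<and> card {F. F facet_of P} \<le> n_star TYPE('d) \<epsilon> \<and>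
     emeasure lebesgue P \<le> ennreal (1 + \<epsilon>) * emeasure lebesgue K"
proof -
  define Q where "Q n \<longleftrightarrow> (\<forall>K :: (real^'d) set.
       convex K \<and> 0 < emeasure lebesgue K \<and> emeasure lebesgue K < \<infinity> \<longrightarrow>
       (\<exists>P. polytope P \<and> K \<subseteq> P \<and> card {F. F facet_of P} \<le> n \<and>
            emeasure lebesgue P \<le> ennreal (1 + \<epsilon>) * emeasure lebesgue K))" for n
  obtain n where n: "\<And>K :: (real^'d) set. convex K \<Longrightarrow> 0 < emeasure lebesgue K \<Longrightarrow> emeasure lebesgue K < \<infinity> \<Longrightarrow>
    \<exists>G. finite G \<and> card G \<le> n \<and> (\<forall>h\<in>G. halfspace h) \<and> K \<subseteq> \<Inter>G \<and>
         emeasure lebesgue (\<Inter>G) \<le> ennreal (1 + \<epsilon>) * emeasure lebesgue K"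
    using ex_uniform_outer_approximation[OF assms(1), where 'd = 'd] by metis
  have "Q n"
    unfolding Q_def
  proof (intro allI impI, elim conjE)
    fix K :: "(real^'d) set"
    assume K: "convex K" "0 < emeasure lebesgue K" "emeasure lebesgue K < \<infinity>"
    then obtain G where G: "finite G" "card G \<le> n" "\<forall>h\<in>G. halfspace h" "K \<subseteq> \<Inter>G"
      "emeasure lebesgue (\<Inter>G) \<le> ennreal (1 + \<epsilon>) * emeasure lebesgue K"
      using n by metis
    have "ennreal (1 + \<epsilon>) * emeasure lebesgue K < \<infinity>"
      using K(3) by (simp add: ennreal_mult_less_top)
    then have "bounded (\<Inter>G)"
      using G K(2) by (intro bounded_Inter_halfspaces[of G K]) auto
    then have "polytope (\<Inter>G)"
      using G(1,3) by (intro polytope_Inter_halfspaces) auto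
    moreover have "card {F. F facet_of \<Inter>G} \<le> n"
      using card_facets_Inter_halfspaces[OF G(1)] G(2,3) by (meson order_trans)
    ultimately show "\<exists>P. polytope P \<and> K \<subseteq> P \<and> card {F. F facet_of P} \<le> n \<and>
        emeasure lebesgue P \<le> ennreal (1 + \<epsilon>) * emeasure lebesgue K"
      using G(4,5) by blast
  qed
  then have "Q (n_star TYPE('d) \<epsilon>)"
    unfolding n_star_def Q_def by (rule LeastI)
  then show ?thesis
    using assms(2-4) by (simp add: Q_def)
qed

text \<open>A polytope around the unit ball given by at most one halfspace would contain a halfspace
  and be unbounded. The bound yields \<open>d + 1 \<le> n d\<close> for Helly's theorem, and it
  makes \<open>n - 1\<close> strictly smaller than \<open>n\<close>.\<close>

lemma n_star_ge_2:
  assumes "\<epsilon> > 0"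
  shows "2 \<le> n_star TYPE('d::finite) \<epsilon>"
proof -
  have "0 < emeasure lebesgue (cball (0::real^'d) 1)"
    by (rule emeasure_convex_pos_iff[OF convex_cball, THEN iffD2]) simp
  moreover have "emeasure lebesgue (cball (0::real^'d) 1) < \<infinity>"
    using fmeasurableD2[OF lmeasurable_cball] by (simp add: less_top)
  ultimately obtain P :: "(real^'d) set" where P: "polytope P" "cball 0 1 \<subseteq> P"
    "card {F. F facet_of P} \<le> n_star TYPE('d) \<epsilon>"
    using n_star_approximation[OF assms convex_cball] by blast
  have "interior P \<noteq> {}"
    using interior_mono[OF P(2)] by auto
  then obtain G where G: "finite G" "card G \<le> card {F. F facet_of P}"
    "\<And>h. h \<in> G \<Longrightarrow> halfspace h" "P = \<Inter>G"
    using polytope_eq_Inter_halfspaces[OF P(1)] by blast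
  have "\<not> card G \<le> 1"
  proof
    assume "card G \<le> 1"
    then obtain h where "G \<subseteq> {h}"
      using G(1) by (metis card_le_Suc0_iff_eq One_nat_def empty_subsetI insertI1 subsetI singleton_iff)
    then obtain a b where a: "a \<noteq> 0" "{x. a \<bullet> x \<le> b} \<subseteq> P"
    proof (cases "G = {}")
      case True
      then show thesis
        using that[of "axis undefined 1" 0] G(4) by (auto simp: axis_eq_0_iff)
    next
      case False
      then have "G = {h}"
        using \<open>G \<subseteq> {h}\<close> by blast
      then show thesis
        using that G(3,4) by (auto simp: halfspace_def)
    qed
    obtain B where B: "\<And>x. x \<in> P \<Longrightarrow> norm x \<le> B"
      using polytope_imp_bounded[OF P(1)] bounded_iff by blast
    \<comment> \<open>The first summand puts \<open>- t a\<close> into the halfspace, the second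
      pushes its norm beyond \<open>B\<close>.\<close>
    define t where "t = \<bar>b\<bar> / (a \<bullet> a) + (\<bar>B\<bar> + 1) / norm a"
    have "a \<bullet> a * t \<ge> \<bar>b\<bar>"
      using a(1) by (simp add: t_def distrib_left)
    then have "a \<bullet> ((- t) *\<^sub>R a) \<le> b"
      by (simp add: mult.commute)
    then have "norm ((- t) *\<^sub>R a) \<le> B"
      using a(2) B by blast
    moreover have "\<bar>t\<bar> \<ge> (\<bar>B\<bar> + 1) / norm a"
      unfolding t_def by (smt (verit) divide_nonneg_nonneg inner_ge_zero abs_ge_zero)
    then have "\<bar>t\<bar> * norm a \<ge> \<bar>B\<bar> + 1"
      using a(1) by (simp add: pos_divide_le_eq)
    ultimately show False
      by simp
  qed
  then show ?thesis
    using G(2) P(3) by linarith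
qed

section \<open>Consequences of Helly's theorem\<close>

lemma Inter_subset_halfspace_Helly:
  fixes \<F> :: "'a::euclidean_space set set"
  assumes \<F>: "finite \<F>" "\<And>C. C \<in> \<F> \<Longrightarrow> convex C" "\<Inter>\<F> \<noteq> {}"
    and h: "halfspace h" "\<Inter>\<F> \<subseteq> h"
  shows "\<exists>\<F>'\<subseteq>\<F>. card \<F>' \<le> DIM('a) \<and> \<Inter>\<F>' \<subseteq> h"
proof (cases "card \<F> \<le> DIM('a)")
  case True
  then show ?thesis
    using h by blast
next
  case False
  have "convex (- h)"
    using h(1) by (auto simp: halfspace_def Collect_neg_eq[symmetric] not_le convex_halfspace_gt)
  have "card (insert (- h) \<F>) \<ge> DIM('a) + 1"
    using False \<F>(1) by (simp add: card_insert_if)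
  moreover have "\<forall>s\<in>insert (- h) \<F>. convex s"
    using \<open>convex (- h)\<close> \<F>(2) by blast
  moreover have "\<Inter>(insert (- h) \<F>) = {}"
    using h by blast
  ultimately obtain t where t: "t \<subseteq> insert (- h) \<F>" "card t = DIM('a) + 1" "\<Inter>t = {}"
    using Helly[of "insert (- h) \<F>"] by blast
  \<comment> \<open>Otherwise \<open>t\<close> would consist of members of the family alone, whose
    intersection is nonempty. Dropping \<open>- h\<close> reduces the count from
    \<open>d + 1\<close> to \<open>d\<close>.\<close>
  have "- h \<in> t"
    using t(1,3) \<F>(3) by blast
  then have "card (t - {- h}) = DIM('a)"
    using t(2) by (simp add: card_Diff_singleton)
  moreover have "\<Inter>(t - {- h}) \<subseteq> h"
    using t(3) by blast
  moreover have "t - {- h} \<subseteq> \<F>"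
    using t(1) by blast
  ultimately show ?thesis
    by (metis order_refl)
qed

lemma interior_finite_Inter: "finite \<F> \<Longrightarrow> interior (\<Inter>\<F>) = \<Inter>(interior ` \<F>)"
  by (induction \<F> rule: finite_induct) auto

text \<open>For convex sets positive volume means nonempty interior, and interiors commute with
  finite intersections, so this is Helly's theorem for the interiors.\<close>

lemma emeasure_Inter_Helly:
  fixes \<F> :: "'a::euclidean_space set set"
  assumes \<F>: "finite \<F>" "\<And>C. C \<in> \<F> \<Longrightarrow> convex C"
    and pos: "\<And>\<F>'. \<F>' \<subseteq> \<F> \<Longrightarrow> card \<F>' \<le> DIM('a) + 1 \<Longrightarrow> 0 < emeasure lebesgue (\<Inter>\<F>')"
  shows "0 < emeasure lebesgue (\<Inter>\<F>)"
proof (rule ccontr)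
  assume "\<not> ?thesis"
  moreover have cv: "convex (\<Inter>\<F>')" if "\<F>' \<subseteq> \<F>" for \<F>'
    using that \<F>(2) by (intro convex_Inter) blast
  ultimately have int: "interior (\<Inter>\<F>) = {}"
    using emeasure_convex_pos_iff[OF cv[OF order_refl]] by simp
  have pos': "interior (\<Inter>\<F>') \<noteq> {}" if "\<F>' \<subseteq> \<F>" "card \<F>' \<le> DIM('a) + 1" for \<F>'
    using pos[OF that] emeasure_convex_pos_iff[OF cv[OF that(1)]] by simp
  have small: False if t: "t \<subseteq> interior ` \<F>" "card t \<le> DIM('a) + 1" "\<Inter>t = {}" for t
  proof -
    \<comment> \<open>Distinct members may share an interior; choosing one member per interior keeps
      the cardinality from growing.\<close>
    obtain \<F>' where \<F>': "\<F>' \<subseteq> \<F>" "inj_on interior \<F>'" "t = interior ` \<F>'"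
      using t(1) unfolding subset_image_inj by blast
    then have "card \<F>' \<le> DIM('a) + 1"
      using t(2) \<F>'(2,3) by (simp add: card_image)
    then show False
      using pos'[OF \<F>'(1)] interior_finite_Inter[OF finite_subset[OF \<F>'(1) \<F>(1)]] \<F>'(3) t(3)
      by simp
  qed
  have I: "\<Inter>(interior ` \<F>) = {}"
    using int interior_finite_Inter[OF \<F>(1)] by simp
  show False
  proof (cases "card (interior ` \<F>) \<le> DIM('a) + 1")
    case True
    then show False
      using small[OF order_refl _ I] by simp
  next
    case False
    have "\<Inter>(interior ` \<F>) \<noteq> {}"
    proof (rule Helly)
      show "DIM('a) + 1 \<le> card (interior ` \<F>)"
        using False by simp
      show "\<forall>C\<in>interior ` \<F>. convex C"
        using \<F>(2) by (auto simp: convex_interior)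
      show "\<Inter>t \<noteq> {}" if "t \<subseteq> interior ` \<F>" "card t = DIM('a) + 1" for t
        using small[OF that(1)] that(2) by auto
    qed
    then show False
      using I by contradiction
  qed
qed

section \<open>Volume bound from subfamilies of size \<open>n d\<close>\<close>

lemma emeasure_Inter_lower_bound:
  fixes \<F> :: "(real^'d) set set"
  assumes \<epsilon>: "\<epsilon> > 0" and \<F>: "finite \<F>" "\<And>C. C \<in> \<F> \<Longrightarrow> convex C"
    and ge1: "\<And>\<F>'. \<F>' \<subseteq> \<F> \<Longrightarrow> card \<F>' \<le> n_star TYPE('d) \<epsilon> * CARD('d) \<Longrightarrow>
      emeasure lebesgue (\<Inter>\<F>') \<ge> 1"
  shows "emeasure lebesgue (\<Inter>\<F>) \<ge> ennreal (inverse (1 + \<epsilon>))"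
proof (rule ccontr)
  assume neg: "\<not> ?thesis"
  define n where "n = n_star TYPE('d) \<epsilon>"
  have "CARD('d) + 1 \<le> 2 * CARD('d)"
    by (simp add: Suc_le_eq)
  also have "\<dots> \<le> n * CARD('d)"
    using n_star_ge_2[OF \<epsilon>] by (simp add: n_def)
  finally have dn: "CARD('d) + 1 \<le> n * CARD('d)" .
  have cv: "convex (\<Inter>\<F>)"
    using \<F>(2) by (rule convex_Inter)
  have "0 < emeasure lebesgue (\<Inter>\<F>)"
  proof (rule emeasure_Inter_Helly[OF \<F>])
    fix \<F>' assume "\<F>' \<subseteq> \<F>" "card \<F>' \<le> DIM(real^'d) + 1"
    then have "1 \<le> emeasure lebesgue (\<Inter>\<F>')"
      using dn by (intro ge1) (auto simp: n_def)
    then show "0 < emeasure lebesgue (\<Inter>\<F>')"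
      by (rule less_le_trans[OF zero_less_one])
  qed
  \<comment> \<open>The negated conclusion also supplies the finite volume that the approximation by
    \<open>P\<close> requires.\<close>
  moreover have "emeasure lebesgue (\<Inter>\<F>) < \<infinity>"
    using neg le_less_trans[OF less_imp_le ennreal_less_top] by (simp add: not_le)
  ultimately obtain P where P: "polytope P" "\<Inter>\<F> \<subseteq> P" "card {F. F facet_of P} \<le> n"
    "emeasure lebesgue P \<le> ennreal (1 + \<epsilon>) * emeasure lebesgue (\<Inter>\<F>)"
    using n_star_approximation[OF \<epsilon> cv] unfolding n_def by blast
  have int: "interior (\<Inter>\<F>) \<noteq> {}"
    using \<open>0 < emeasure lebesgue (\<Inter>\<F>)\<close> emeasure_convex_pos_iff[OF cv] by blast
  then have "interior P \<noteq> {}"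
    using interior_mono[OF P(2)] by blast
  then obtain G where G: "finite G" "card G \<le> card {F. F facet_of P}"
    "\<And>h. h \<in> G \<Longrightarrow> halfspace h" "P = \<Inter>G"
    using polytope_eq_Inter_halfspaces[OF P(1)] by blast
  have "\<exists>\<F>'\<subseteq>\<F>. card \<F>' \<le> CARD('d) \<and> \<Inter>\<F>' \<subseteq> h" if "h \<in> G" for h
  proof -
    have "\<Inter>\<F> \<subseteq> h" "\<Inter>\<F> \<noteq> {}"
      using P(2) G(4) that int interior_subset by blast+
    then show ?thesis
      using Inter_subset_halfspace_Helly[of \<F> h] \<F> G(3)[OF that] by simp
  qed
  then obtain \<Phi> where \<Phi>: "\<And>h. h \<in> G \<Longrightarrow> \<Phi> h \<subseteq> \<F> \<and> card (\<Phi> h) \<le> CARD('d) \<and> \<Inter>(\<Phi> h) \<subseteq> h"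
    by metis
  have "card (\<Union>h\<in>G. \<Phi> h) \<le> (\<Sum>h\<in>G. card (\<Phi> h))"
    using G(1) by (rule card_UN_le)
  also have "\<dots> \<le> card G * CARD('d)"
    using \<Phi> by (intro order_trans[OF sum_bounded_above]) auto
  also have "\<dots> \<le> n * CARD('d)"
    using G(2) P(3) by (intro mult_right_mono) auto
  finally have "card (\<Union>h\<in>G. \<Phi> h) \<le> n_star TYPE('d) \<epsilon> * CARD('d)"
    unfolding n_def .
  moreover have "(\<Union>h\<in>G. \<Phi> h) \<subseteq> \<F>"
    using \<Phi> by (intro UN_least) simp
  ultimately have "1 \<le> emeasure lebesgue (\<Inter>(\<Union>h\<in>G. \<Phi> h))"
    by (intro ge1)
  also have "\<dots> \<le> emeasure lebesgue P"
  proof (rule emeasure_mono)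
    show "\<Inter>(\<Union>h\<in>G. \<Phi> h) \<subseteq> P"
      unfolding G(4)
    proof (rule Inter_greatest)
      fix h assume "h \<in> G"
      then have "\<Phi> h \<subseteq> (\<Union>h\<in>G. \<Phi> h)" "\<Inter>(\<Phi> h) \<subseteq> h"
        using \<Phi> by auto
      then show "\<Inter>(\<Union>h\<in>G. \<Phi> h) \<subseteq> h"
        using Inter_anti_mono by (metis order_trans)
    qed
    show "P \<in> sets lebesgue"
      using polytope_imp_convex[OF P(1)] by (rule sets_lebesgue_convex)
  qed
  also have "\<dots> \<le> ennreal (1 + \<epsilon>) * emeasure lebesgue (\<Inter>\<F>)"
    by (rule P(4))
  also have "\<dots> < ennreal (1 + \<epsilon>) * ennreal (inverse (1 + \<epsilon>))"
  proof (rule ennreal_mult_strict_left_mono)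
    show "emeasure lebesgue (\<Inter>\<F>) < ennreal (inverse (1 + \<epsilon>))"
      using neg by (simp add: not_le)
    have "0 < 1 + \<epsilon>"
      using \<epsilon> by simp
    then show "0 < ennreal (1 + \<epsilon>)"
      by (rule ennreal_less_zero_iff[THEN iffD2])
  qed simp
  also have "\<dots> = 1"
    using \<epsilon> by (subst ennreal_mult[symmetric]) auto
  finally show False
    by simp
qed

section \<open>Sharpness: a family for which \<open>n - 1\<close> is too small\<close>

text \<open>Minimality speaks of polytopes with at most \<open>m\<close> facets. An intersection of
  at most \<open>m\<close> halfspaces violating the inequality would have finite volume, hence be
  bounded and such a polytope.\<close>

lemma n_star_minimal:
  fixes \<epsilon> :: real
  assumes "\<epsilon> > 0" "m < n_star TYPE('d::finite) \<epsilon>"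
  obtains K :: "(real^'d) set" where "convex K" "0 < emeasure lebesgue K" "emeasure lebesgue K < \<infinity>"
    "\<And>G. finite G \<Longrightarrow> card G \<le> m \<Longrightarrow> \<forall>h\<in>G. halfspace h \<Longrightarrow> K \<subseteq> \<Inter>G \<Longrightarrow>
       ennreal (1 + \<epsilon>) * emeasure lebesgue K < emeasure lebesgue (\<Inter>G)"
proof -
  obtain K :: "(real^'d) set" where K: "convex K" "0 < emeasure lebesgue K" "emeasure lebesgue K < \<infinity>"
    and bad: "\<And>P. polytope P \<Longrightarrow> K \<subseteq> P \<Longrightarrow> card {F. F facet_of P} \<le> m \<Longrightarrow>
      \<not> emeasure lebesgue P \<le> ennreal (1 + \<epsilon>) * emeasure lebesgue K"
    using not_less_Least[OF assms(2)[unfolded n_star_def]] by blast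
  have "ennreal (1 + \<epsilon>) * emeasure lebesgue K < emeasure lebesgue (\<Inter>G)"
    if G: "finite G" "card G \<le> m" "\<forall>h\<in>G. halfspace h" "K \<subseteq> \<Inter>G" for G
  proof (rule ccontr)
    assume "\<not> ?thesis"
    then have le: "emeasure lebesgue (\<Inter>G) \<le> ennreal (1 + \<epsilon>) * emeasure lebesgue K"
      by simp
    also have "\<dots> < \<infinity>"
      using K(3) by (simp add: ennreal_mult_less_top)
    finally have "bounded (\<Inter>G)"
      using G K(2) by (intro bounded_Inter_halfspaces[of G K]) auto
    then have "polytope (\<Inter>G)"
      using G(1,3) by (intro polytope_Inter_halfspaces) auto
    moreover have "card {F. F facet_of \<Inter>G} \<le> m"
      using card_facets_Inter_halfspaces[OF G(1)] G(2,3) by (meson order_trans)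
    ultimately show False
      using bad G(4) le by blast
  qed
  then show thesis
    using K that by blast
qed

lemma Inter_family_below_threshold:
  fixes \<epsilon> :: real
  assumes \<epsilon>: "\<epsilon> > 0"
  shows "\<exists>\<F> :: (real^'d) set set.
            finite \<F> \<and> (\<forall>C\<in>\<F>. convex C) \<and>
            (\<forall>\<F>'. \<F>' \<subseteq> \<F> \<and> card \<F>' \<le> n_star TYPE('d) \<epsilon> - 1 \<longrightarrow> emeasure lebesgue (\<Inter>\<F>') \<ge> 1) \<and>
            emeasure lebesgue (\<Inter>\<F>) < ennreal (inverse (1 + \<epsilon>))"
proof -
  define m where "m = n_star TYPE('d) \<epsilon> - 1"
  have "m < n_star TYPE('d) \<epsilon>"
    using n_star_ge_2[OF \<epsilon>, where 'd = 'd] by (simp add: m_def)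
  then obtain K :: "(real^'d) set" where K: "convex K" "0 < emeasure lebesgue K" "emeasure lebesgue K < \<infinity>"
    and bad: "\<And>G. finite G \<Longrightarrow> card G \<le> m \<Longrightarrow> \<forall>h\<in>G. halfspace h \<Longrightarrow> K \<subseteq> \<Inter>G \<Longrightarrow>
       ennreal (1 + \<epsilon>) * emeasure lebesgue K < emeasure lebesgue (\<Inter>G)"
    using n_star_minimal[OF \<epsilon>] by blast
  define \<kappa> where "\<kappa> = measure lebesgue K"
  have \<kappa>: "emeasure lebesgue K = ennreal \<kappa>"
    unfolding \<kappa>_def using K(3) by (intro emeasure_eq_ennreal_measure) auto
  have "\<kappa> > 0"
    using K(2) by (simp add: \<kappa>)
  have "K \<noteq> {}"
    using K(2) by auto
  have "ennreal (1 + \<epsilon>) * emeasure lebesgue K < \<infinity>"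
    using K(3) by (simp add: ennreal_mult_less_top)
  then have "\<exists>V'>ennreal (1 + \<epsilon>) * emeasure lebesgue K. \<forall>G. finite G \<and> card G \<le> m \<and>
      (\<forall>h\<in>G. halfspace h) \<and> K \<subseteq> \<Inter>G \<longrightarrow> V' \<le> emeasure lebesgue (\<Inter>G)"
    using bounded_convex_finite_emeasure[OF K] \<open>K \<noteq> {}\<close> bad
    by (intro emeasure_Inter_halfspaces_gap)
  then obtain V' where V': "V' > ennreal (1 + \<epsilon>) * emeasure lebesgue K"
    "\<forall>G. finite G \<and> card G \<le> m \<and> (\<forall>h\<in>G. halfspace h) \<and> K \<subseteq> \<Inter>G \<longrightarrow> V' \<le> emeasure lebesgue (\<Inter>G)"
    by (elim exE conjE) (rule that)
  \<comment> \<open>\<open>V'\<close> may be infinite; a real number in between is needed for the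
    scaling.\<close>
  obtain V where V: "(1 + \<epsilon>) * \<kappa> < V" "ennreal V \<le> V'"
  proof (cases V' rule: ennreal_cases)
    case (real v)
    have "ennreal ((1 + \<epsilon>) * \<kappa>) = ennreal (1 + \<epsilon>) * ennreal \<kappa>"
      using \<epsilon> \<open>\<kappa> > 0\<close> by (intro ennreal_mult) auto
    also have "\<dots> < ennreal v"
      using V'(1) unfolding real(2) \<kappa> .
    finally have "(1 + \<epsilon>) * \<kappa> < v"
      by (simp add: ennreal_less_iff \<epsilon> \<open>\<kappa> > 0\<close> less_imp_le)
    then show thesis
      using that real by simp
  next
    case top
    then show thesis
      using that[of "(1 + \<epsilon>) * \<kappa> + 1"] by simp
  qed
  have "V > 0"
    using V(1) \<epsilon> \<open>\<kappa> > 0\<close> by (smt (verit) mult_pos_pos)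
  \<comment> \<open>\<open>\<rho>\<close> measures the slack between \<open>V\<close> and
    \<open>(1 + \<epsilon>) * \<kappa>\<close>; half of its excess over 1 is allowed for the
    approximation of \<open>K\<close> by \<open>G\<close>, which keeps the final inequality
    strict.\<close>
  define \<rho> where "\<rho> = V / ((1 + \<epsilon>) * \<kappa>)"
  have "\<rho> > 1" "\<rho> * \<kappa> = V / (1 + \<epsilon>)"
    using V(1) \<epsilon> \<open>\<kappa> > 0\<close> by (simp_all add: \<rho>_def)
  define \<eta> where "\<eta> = (\<rho> - 1) / 2"
  have "\<eta> > 0" "1 + \<eta> < \<rho>"
    using \<open>\<rho> > 1\<close> by (simp_all add: \<eta>_def field_simps)
  then have \<eta>: "\<eta> > 0" "(1 + \<eta>) * \<kappa> < V / (1 + \<epsilon>)"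
    using \<open>\<kappa> > 0\<close> by (simp_all flip: \<open>\<rho> * \<kappa> = V / (1 + \<epsilon>)\<close>)
  obtain G where G: "finite G" "\<forall>h\<in>G. halfspace h" "K \<subseteq> \<Inter>G"
    "emeasure lebesgue (\<Inter>G) \<le> ennreal (1 + \<eta>) * emeasure lebesgue K"
    using ex_uniform_outer_approximation[OF \<eta>(1), where 'd = 'd] K by blast
  \<comment> \<open>Scaling by \<open>t\<close> divides volumes by \<open>V\<close>, so the lower
    bound for small subfamilies becomes 1.\<close>
  define t where "t = root CARD('d) (1 / V)"
  have "t > 0"
    using \<open>V > 0\<close> by (simp add: t_def)
  have tV: "t ^ CARD('d) = 1 / V"
    using \<open>V > 0\<close> by (simp add: t_def)
  define S where "S = (\<lambda>X :: (real^'d) set. (*\<^sub>R) t ` X)"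
  have vol_S: "emeasure lebesgue (S X) = ennreal (1 / V) * emeasure lebesgue X" for X
    using emeasure_lebesgue_affine[of t 0 X] \<open>t > 0\<close> by (simp add: S_def ennreal_power tV)
  have S_Inter: "\<Inter>(S ` H) = S (\<Inter>H)" for H
  proof (cases "H = {}")
    \<comment> \<open>The empty subfamily has the whole space as intersection, which scaling maps
      onto itself.\<close>
    case True
    have "surj ((*\<^sub>R) t :: real^'d \<Rightarrow> _)"
      using \<open>t > 0\<close> by (intro surjI[of _ "(*\<^sub>R) (1 / t)"]) simp
    then show ?thesis
      by (simp add: True S_def)
  next
    case False
    then show ?thesis
      using image_INT[of "(*\<^sub>R) t" UNIV H id] \<open>t > 0\<close> by (auto simp: S_def inj_on_def)
  qed
  have "emeasure lebesgue (\<Inter>\<F>') \<ge> 1" if \<F>': "\<F>' \<subseteq> S ` G" "card \<F>' \<le> m" for \<F>'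
  proof -
    \<comment> \<open>Preimages are chosen injectively, so \<open>H\<close> has as many members as
      the subfamily.\<close>
    obtain H where H: "H \<subseteq> G" "inj_on S H" "\<F>' = S ` H"
      using \<F>'(1) unfolding subset_image_inj by blast
    then have "card H \<le> m"
      using \<F>'(2) by (simp add: card_image)
    then have "V' \<le> emeasure lebesgue (\<Inter>H)"
      using H G V'(2) finite_subset[OF H(1) G(1)] by blast
    then have "ennreal V \<le> emeasure lebesgue (\<Inter>H)"
      using V(2) by (rule order_trans[rotated])
    then have "ennreal (1 / V) * ennreal V \<le> emeasure lebesgue (\<Inter>\<F>')"
      by (simp add: H(3) S_Inter vol_S mult_left_mono)
    then show ?thesis
      using \<open>V > 0\<close> by (simp add: ennreal_mult[symmetric])
  qed
  moreover have "emeasure lebesgue (\<Inter>(S ` G)) < ennreal (inverse (1 + \<epsilon>))"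
  proof -
    have "emeasure lebesgue (\<Inter>(S ` G)) \<le> ennreal (1 / V) * (ennreal (1 + \<eta>) * ennreal \<kappa>)"
      using G(4) by (simp add: S_Inter vol_S \<kappa> mult_left_mono)
    also have "\<dots> = ennreal (((1 + \<eta>) * \<kappa>) / V)"
      using \<eta>(1) \<open>\<kappa> > 0\<close> \<open>V > 0\<close> by (simp add: ennreal_mult[symmetric] del: ennreal_plus)
    also have "\<dots> < ennreal (inverse (1 + \<epsilon>))"
    proof (rule ennreal_lessI)
      show "0 < inverse (1 + \<epsilon>)"
        using \<epsilon> by simp
      have "((1 + \<eta>) * \<kappa>) / V < (V / (1 + \<epsilon>)) / V"
        using \<eta>(2) \<open>V > 0\<close> by (rule divide_strict_right_mono)
      then show "((1 + \<eta>) * \<kappa>) / V < inverse (1 + \<epsilon>)"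
        using \<open>V > 0\<close> by (simp add: inverse_eq_divide)
    qed
    finally show ?thesis .
  qed
  moreover have "\<forall>C\<in>S ` G. convex C"
    using G(2) by (auto simp: S_def intro: convex_scaling halfspace_imp_convex)
  ultimately show ?thesis
    using G(1) unfolding m_def by (intro exI[of _ "S ` G"]) auto
qed

theorem theorem3p1:
  fixes \<epsilon> :: real and n :: nat
  assumes "\<epsilon> > 0"
    and "n = n_star TYPE('d::finite) \<epsilon>"
  shows "(\<forall>\<F> :: (real^'d) set set.
            finite \<F> \<and> (\<forall>C\<in>\<F>. convex C) \<and>
            (\<forall>\<F>'. \<F>' \<subseteq> \<F> \<and> card \<F>' \<le> n * CARD('d) \<longrightarrow> emeasure lebesgue (\<Inter>\<F>') \<ge> 1) \<longrightarrow>
            emeasure lebesgue (\<Inter>\<F>) \<ge> ennreal (inverse (1 + \<epsilon>)))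
       \<and> (\<exists>\<F> :: (real^'d) set set.
            finite \<F> \<and> (\<forall>C\<in>\<F>. convex C) \<and>
            (\<forall>\<F>'. \<F>' \<subseteq> \<F> \<and> card \<F>' \<le> n - 1 \<longrightarrow> emeasure lebesgue (\<Inter>\<F>') \<ge> 1) \<and>
            emeasure lebesgue (\<Inter>\<F>) < ennreal (inverse (1 + \<epsilon>)))"
  unfolding assms(2)
proof (intro conjI allI impI)
  fix \<F> :: "(real^'d) set set"
  assume "finite \<F> \<and> (\<forall>C\<in>\<F>. convex C) \<and>
    (\<forall>\<F>'. \<F>' \<subseteq> \<F> \<and> card \<F>' \<le> n_star TYPE('d) \<epsilon> * CARD('d) \<longrightarrow> emeasure lebesgue (\<Inter>\<F>') \<ge> 1)"
  then show "emeasure lebesgue (\<Inter>\<F>) \<ge> ennreal (inverse (1 + \<epsilon>))"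
    by (intro emeasure_Inter_lower_bound[OF assms(1)]) simp_all
qed (rule Inter_family_below_threshold[OF assms(1)])

end
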